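(* Let $\ell_n:\mathbb{R}^p\to\mathbb{R}$ be a convex loss (not necessarily differentiable), let $\beta^\star\in\mathbb{R}^p$ be the true parameter with support $\mathcal{A}=\{j:\beta^\star_j\neq 0\}$, let $\lambda>0$, and let $P_\lambda$ be a folded concave penalty with constants $a_1,a_2,a$. Consider the problem $\min_\beta \ell_n(\beta)+\sum_jP_\lambda(|\beta_j|)$. Under the event $$\mathcal{E}_2=\left\{\|\nabla_{\mathcal{A}^c}\ell_n(\hat\beta^{\mathrm{oracle}})\|_{\max}<a_1\lambda\right\}\cap\left\{\|\hat\beta^{\mathrm{oracle}}_{\mathcal{A}}\|_{\min}>a\lambda\right\},$$ if $\hat\beta^{\mathrm{oracle}}$ is obtained at some iteration of the LLA algorithm, then the LLA algorithm finds $\hat\beta^{\mathrm{oracle}}$ again in the next iteration; that is, it converges to $\hat\beta^{\mathrm{oracle}}$ in the next iteration and $\hat\beta^{\mathrm{oracle}}$ is a fixed point of the LLA iteration.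
   Context: Notation: $\|v\|_{\max}=\max_j|v_j|$, $\|v\|_{\min}=\min_j|v_j|$; $v_{\mathcal{A}}$ is the subvector indexed by $\mathcal{A}$. Folded concave penalty: $P_\lambda(|t|)$, $t\in\mathbb{R}$, where, for fixed constants $a_1,a_2>0$ and $a>a_2$: (i) $P_\lambda(t)$ is increasing and concave on $[0,\infty)$ with $P_\lambda(0)=0$; (ii) $P_\lambda$ is differentiable on $(0,\infty)$ with $P'_\lambda(0):=P'_\lambda(0+)\ge a_1\lambda$; (iii) $P'_\lambda(t)\ge a_1\lambda$ for $t\in(0,a_2\lambda]$; (iv) $P'_\lambda(t)=0$ for $t\in[a\lambda,\infty)$. Oracle estimator: $\hat\beta^{\mathrm{oracle}}=(\hat\beta^{\mathrm{oracle}}_{\mathcal{A}},0)=\arg\min_{\beta:\beta_{\mathcal{A}^c}=0}\ell_n(\beta)$. Standing assumption: this minimizer exists and is unique, and $\nabla_j\ell_n(\hat\beta^{\mathrm{oracle}})=0$ for all $j\in\mathcal{A}$. Here $\nabla\ell_n(\hat\beta^{\mathrm{oracle}})$ denotes a (fixed) subgradient vector of $\ell_n$ at $\hat\beta^{\mathrm{oracle}}$ with this property (the gradient if $\ell_n$ is differentiable), and $\nabla_{\mathcal{A}^c}\ell_n(\hat\beta^{\mathrm{oracle}})$ is its subvector indexed by $\mathcal{A}^c$. LLA (local linear approximation) algorithm: set $\hat\beta^{(0)}$ to an initial estimator; for $m=1,2,\ldots$ let $\hat w^{(m-1)}_j=P'_\lambda(|\hat\beta^{(m-1)}_j|)$ and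 $\hat\beta^{(m)}=\arg\min_\beta\ \ell_n(\beta)+\sum_j\hat w^{(m-1)}_j|\beta_j|$. *)

theory Defs
  imports "HOL-Analysis.Analysis"
begin

text \<open>
  The maximum and minimum of the absolute entries of the subvector of \<open>v\<close> indexed by \<open>S\<close>.
  They are extended-real valued, so that an empty subvector satisfies every upper bound on
  the first and every lower bound on the second; on nonempty \<open>S\<close> they are an ordinary \<open>Max\<close>
  and \<open>Min\<close>, as the two lemmas below state.
\<close>

definition sub_max_norm :: "'p set \<Rightarrow> real ^ 'p::finite \<Rightarrow> ereal" where
  "sub_max_norm S v = (SUP j\<in>S. ereal \<bar>v $ j\<bar>)"

definition sub_min_norm :: "'p set \<Rightarrow> real ^ 'p::finite \<Rightarrow> ereal" where
  "sub_min_norm S v = (INF j\<in>S. ereal \<bar>v $ j\<bar>)"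

lemma sub_max_norm_eq_Max:
  assumes "S \<noteq> {}"
  shows "sub_max_norm S v = ereal (Max ((\<lambda>j. \<bar>v $ j\<bar>) ` S))"
proof -
  have "ereal (Max ((\<lambda>j. \<bar>v $ j\<bar>) ` S)) = Max (ereal ` ((\<lambda>j. \<bar>v $ j\<bar>) ` S))"
    using assms by (intro mono_Max_commute) (auto simp: mono_def)
  then show ?thesis
    using assms by (simp add: sub_max_norm_def image_image Max_Sup)
qed

lemma sub_min_norm_eq_Min:
  assumes "S \<noteq> {}"
  shows "sub_min_norm S v = ereal (Min ((\<lambda>j. \<bar>v $ j\<bar>) ` S))"
proof -
  have "ereal (Min ((\<lambda>j. \<bar>v $ j\<bar>) ` S)) = Min (ereal ` ((\<lambda>j. \<bar>v $ j\<bar>) ` S))"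
    using assms by (intro mono_Min_commute) (auto simp: mono_def)
  then show ?thesis
    using assms by (simp add: sub_min_norm_def image_image Min_Inf)
qed

text \<open>
  The derivative of a penalty on \<open>[0,\<infinity>)\<close>, with the convention that its value at \<open>0\<close> is the
  right limit of the derivative.
\<close>

definition penalty_deriv :: "(real \<Rightarrow> real) \<Rightarrow> real \<Rightarrow> real" where
  "penalty_deriv P t = (if t = 0 then Lim (at_right 0) (deriv P) else deriv P t)"

text \<open>
  Here \<open>P\<close> is the function \<open>P\<^sub>\<lambda>\<close> for one fixed value \<open>lam\<close> of \<open>\<lambda>\<close>; only its values on \<open>[0,\<infinity>)\<close>
  matter. \<^emph>\<open>Increasing\<close> has to be read in the weak sense, since \<open>P\<close> is constant on
  \<open>[a * lam, \<infinity>)\<close>. The existence of the right limit of the derivative is part of the requirement,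
  as \<open>Lim\<close> is unspecified otherwise.
\<close>

definition folded_concave_penalty ::
    "real \<Rightarrow> real \<Rightarrow> real \<Rightarrow> real \<Rightarrow> (real \<Rightarrow> real) \<Rightarrow> bool" where
  "folded_concave_penalty a1 a2 a lam P \<longleftrightarrow>
     0 < a1 \<and> 0 < a2 \<and> a2 < a \<and>
     mono_on {0..} P \<and> concave_on {0..} P \<and> P 0 = 0 \<and>
     P differentiable_on {0<..} \<and>
     (\<exists>L. (deriv P \<longlongrightarrow> L) (at_right 0)) \<and> a1 * lam \<le> penalty_deriv P 0 \<and>
     (\<forall>t\<in>{0<..a2 * lam}. a1 * lam \<le> penalty_deriv P t) \<and>
     (\<forall>t\<in>{a * lam..}. penalty_deriv P t = 0)"

definition is_subgradient :: "('a::real_inner \<Rightarrow> real) \<Rightarrow> 'a \<Rightarrow> 'a \<Rightarrow> bool" where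
  "is_subgradient f x g \<longleftrightarrow> (\<forall>y. f x + g \<bullet> (y - x) \<le> f y)"

text \<open>\<open>b\<close> is the unique minimizer of \<open>ell\<close> among the vectors that vanish outside \<open>A\<close>.\<close>

definition is_oracle_estimator ::
    "(real ^ 'p::finite \<Rightarrow> real) \<Rightarrow> 'p set \<Rightarrow> real ^ 'p \<Rightarrow> bool" where
  "is_oracle_estimator ell A b \<longleftrightarrow>
     is_arg_min ell (\<lambda>\<beta>. \<forall>j. j \<notin> A \<longrightarrow> \<beta> $ j = 0) b \<and>
     (\<forall>b'. is_arg_min ell (\<lambda>\<beta>. \<forall>j. j \<notin> A \<longrightarrow> \<beta> $ j = 0) b' \<longrightarrow> b' = b)"

definition lla_objective ::
    "(real ^ 'p::finite \<Rightarrow> real) \<Rightarrow> (real \<Rightarrow> real) \<Rightarrow> real ^ 'p \<Rightarrow> real ^ 'p \<Rightarrow> real" where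
  "lla_objective ell P b \<beta> = ell \<beta> + (\<Sum>j\<in>UNIV. penalty_deriv P \<bar>b $ j\<bar> * \<bar>\<beta> $ j\<bar>)"

text \<open>
  One iteration is a relation, since the weighted problem may in general have several
  minimizers (or none); \<open>b'\<close> is an admissible successor of \<open>b\<close> if it is one of them.
\<close>

definition lla_step ::
    "(real ^ 'p::finite \<Rightarrow> real) \<Rightarrow> (real \<Rightarrow> real) \<Rightarrow> real ^ 'p \<Rightarrow> real ^ 'p \<Rightarrow> bool" where
  "lla_step ell P b b' \<longleftrightarrow> is_arg_min (lla_objective ell P b) (\<lambda>_. True) b'"

definition lla_iterates ::
    "(real ^ 'p::finite \<Rightarrow> real) \<Rightarrow> (real \<Rightarrow> real) \<Rightarrow> (nat \<Rightarrow> real ^ 'p) \<Rightarrow> bool" where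
  "lla_iterates ell P \<beta>s \<longleftrightarrow> (\<forall>m. lla_step ell P (\<beta>s m) (\<beta>s (Suc m)))"

end

theory Submission
  imports Defs
begin

text \<open>
  Linearizing the penalty at the oracle estimator gives weight \<open>0\<close> on \<open>A\<close> and a weight of at
  least \<open>a1 * lam\<close> off \<open>A\<close>. The subgradient \<open>g\<close> vanishes on \<open>A\<close> and is smaller than that weight
  off \<open>A\<close>, so moving any coordinate off \<open>A\<close> away from \<open>0\<close> strictly increases the weighted
  objective. Among vectors supported on \<open>A\<close> the weighted objective is just the loss, whose unique
  minimizer is the oracle estimator.
\<close>

lemma abs_less_if_sub_max_norm_less:
  assumes "sub_max_norm S v < ereal c" "j \<in> S"
  shows "\<bar>v $ j\<bar> < c"
proof -
  have "ereal \<bar>v $ j\<bar> \<le> sub_max_norm S v"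
    unfolding sub_max_norm_def using assms(2) by (rule SUP_upper)
  also note assms(1)
  finally show ?thesis by simp
qed

lemma abs_greater_if_sub_min_norm_greater:
  assumes "ereal c < sub_min_norm S v" "j \<in> S"
  shows "c < \<bar>v $ j\<bar>"
proof -
  note assms(1)
  also have "sub_min_norm S v \<le> ereal \<bar>v $ j\<bar>"
    unfolding sub_min_norm_def using assms(2) by (rule INF_lower)
  finally show ?thesis by simp
qed

text \<open>The subgradient inequality at \<open>b\<close> bounds the loss below by a linear term
  that involves only coordinates off \<open>A\<close>. There each \<open>g $ j * x $ j\<close> is at
  worst \<open>- \<bar>g $ j\<bar> * \<bar>x $ j\<bar>\<close>, which is charged against the weight
  \<open>w j\<close>; what remains of the weight is the slack sum.\<close>

lemma weighted_objective_growth: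
  fixes ell :: "real ^ 'p::finite \<Rightarrow> real"
  assumes sub: "is_subgradient ell b g"
    and g: "\<And>j. j \<in> A \<Longrightarrow> g $ j = 0"
    and b: "\<And>j. j \<notin> A \<Longrightarrow> b $ j = 0"
    and w: "\<And>j. j \<in> A \<Longrightarrow> w j = 0"
  shows "ell b + (\<Sum>j\<in>UNIV. w j * \<bar>b $ j\<bar>) + (\<Sum>j\<in>-A. (w j - \<bar>g $ j\<bar>) * \<bar>x $ j\<bar>)
    \<le> ell x + (\<Sum>j\<in>UNIV. w j * \<bar>x $ j\<bar>)"
proof -
  \<comment> \<open>On \<open>A\<close> the weight vanishes, off \<open>A\<close> the entry of
    \<open>b\<close> does.\<close>
  have "w j * \<bar>b $ j\<bar> = 0" for j
    using b w by (cases "j \<in> A") auto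
  then have b0: "(\<Sum>j\<in>UNIV. w j * \<bar>b $ j\<bar>) = 0"
    by (intro sum.neutral ballI)
  have wx: "(\<Sum>j\<in>UNIV. w j * \<bar>x $ j\<bar>) = (\<Sum>j\<in>-A. w j * \<bar>x $ j\<bar>)"
    using w by (intro sum.mono_neutral_right) auto
  have "g \<bullet> (x - b) = (\<Sum>j\<in>UNIV. g $ j * (x $ j - b $ j))"
    by (simp add: inner_vec_def)
  also have "\<dots> = (\<Sum>j\<in>-A. g $ j * (x $ j - b $ j))"
    using g by (intro sum.mono_neutral_right) auto
  also have "\<dots> = (\<Sum>j\<in>-A. g $ j * x $ j)"
    using b by (intro sum.cong) auto
  finally have "ell b + (\<Sum>j\<in>-A. g $ j * x $ j) \<le> ell x"
    using sub unfolding is_subgradient_def by metis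
  moreover have "(\<Sum>j\<in>-A. (w j - \<bar>g $ j\<bar>) * \<bar>x $ j\<bar>)
      \<le> (\<Sum>j\<in>-A. g $ j * x $ j + w j * \<bar>x $ j\<bar>)"
  proof (rule sum_mono)
    fix j
    have "- (g $ j * x $ j) \<le> \<bar>g $ j\<bar> * \<bar>x $ j\<bar>"
      by (metis abs_ge_minus_self abs_mult)
    then show "(w j - \<bar>g $ j\<bar>) * \<bar>x $ j\<bar> \<le> g $ j * x $ j + w j * \<bar>x $ j\<bar>"
      by (simp add: algebra_simps)
  qed
  ultimately show ?thesis
    by (simp add: b0 wx sum.distrib)
qed

text \<open>The penalty enters only through its weights at \<open>b0\<close>. Strictness in
  \<open>gw\<close> confines every minimizer to the support \<open>A\<close>, and uniqueness of the
  oracle estimator then singles out \<open>b0\<close>.\<close>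

lemma lla_step_oracle_iff:
  fixes ell :: "real ^ 'p::finite \<Rightarrow> real"
  assumes or: "is_oracle_estimator ell A b0"
    and sub: "is_subgradient ell b0 g"
    and g: "\<And>j. j \<in> A \<Longrightarrow> g $ j = 0"
    and wA: "\<And>j. j \<in> A \<Longrightarrow> penalty_deriv P \<bar>b0 $ j\<bar> = 0"
    and gw: "\<And>j. j \<notin> A \<Longrightarrow> \<bar>g $ j\<bar> < penalty_deriv P 0"
  shows "lla_step ell P b0 b \<longleftrightarrow> b = b0"
proof -
  define w where "w j = penalty_deriv P \<bar>b0 $ j\<bar>" for j
  have b0: "b0 $ j = 0" if "j \<notin> A" for j
    using or that unfolding is_oracle_estimator_def is_arg_min_def by blast
  have w: "w j = 0" if "j \<in> A" for j
    using wA that by (simp add: w_def)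
  \<comment> \<open>Off \<open>A\<close> the entry of \<open>b0\<close> is \<open>0\<close>, so the
    weight there is the right limit \<open>penalty_deriv P 0\<close>.\<close>
  have gap: "0 < w j - \<bar>g $ j\<bar>" if "j \<notin> A" for j
    using gw[OF that] b0[OF that] by (simp add: w_def)
  have growth: "lla_objective ell P b0 b0 + (\<Sum>j\<in>-A. (w j - \<bar>g $ j\<bar>) * \<bar>x $ j\<bar>)
      \<le> lla_objective ell P b0 x" for x
    unfolding lla_objective_def w_def[symmetric]
    by (rule weighted_objective_growth[OF sub g b0 w])
  have term_nonneg: "0 \<le> (w j - \<bar>g $ j\<bar>) * \<bar>x $ j\<bar>" if "j \<in> -A" for x :: "real ^ 'p" and j
    using gap that by (simp add: less_imp_le)
  have gap_sum_nonneg: "0 \<le> (\<Sum>j\<in>-A. (w j - \<bar>g $ j\<bar>) * \<bar>x $ j\<bar>)" for x :: "real ^ 'p"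
    using term_nonneg by (rule sum_nonneg)
  have min: "lla_objective ell P b0 b0 \<le> lla_objective ell P b0 x" for x
    using growth[of x] gap_sum_nonneg[of x] by linarith
  have on_A: "lla_objective ell P b0 x = ell x" if "\<And>j. j \<notin> A \<Longrightarrow> x $ j = 0" for x
  proof -
    have "w j * \<bar>x $ j\<bar> = 0" for j
      using w that by (cases "j \<in> A") auto
    then have "(\<Sum>j\<in>UNIV. w j * \<bar>x $ j\<bar>) = 0"
      by (intro sum.neutral ballI)
    then show ?thesis
      by (simp add: lla_objective_def w_def[symmetric])
  qed
  show ?thesis
  proof
    assume "lla_step ell P b0 b"
    then have le: "lla_objective ell P b0 b \<le> lla_objective ell P b0 b0"
      by (auto simp: lla_step_def is_arg_min_def not_less)
    \<comment> \<open>Minimality of \<open>b\<close> squeezes the nonnegative slack between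
      \<open>0\<close> and \<open>0\<close>.\<close>
    then have "(\<Sum>j\<in>-A. (w j - \<bar>g $ j\<bar>) * \<bar>b $ j\<bar>) = 0"
      using growth[of b] gap_sum_nonneg[of b] by linarith
    then have zero: "\<forall>j\<in>-A. (w j - \<bar>g $ j\<bar>) * \<bar>b $ j\<bar> = 0"
      by (subst (asm) sum_nonneg_eq_0_iff) (auto intro: term_nonneg)
    have b: "b $ j = 0" if "j \<notin> A" for j
      using bspec[OF zero, of j] gap[OF that] that by simp
    have "ell b \<le> ell b0"
      using le on_A[of b, OF b] on_A[of b0, OF b0] by linarith
    \<comment> \<open>\<open>b\<close> is now feasible for the restricted problem and does no worse
      than its minimizer \<open>b0\<close>, so it is a minimizer too.\<close>
    then have "is_arg_min ell (\<lambda>\<beta>. \<forall>j. j \<notin> A \<longrightarrow> \<beta> $ j = 0) b"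
      using or b unfolding is_oracle_estimator_def is_arg_min_def
      by (meson less_le_trans)
    then show "b = b0"
      using or unfolding is_oracle_estimator_def by blast
  next
    assume "b = b0"
    then show "lla_step ell P b0 b"
      using min by (auto simp: lla_step_def is_arg_min_def not_less)
  qed
qed

text \<open>Since a step is a relation, staying at \<open>b0\<close> rests on \<open>b0\<close>
  having no other successor; induction from \<open>m\<close> does the rest.\<close>

lemma lla_iterates_fixed_point:
  assumes it: "lla_iterates ell P \<beta>s" and start: "\<beta>s m = b0"
    and fix_b0: "\<And>b. lla_step ell P b0 b \<Longrightarrow> b = b0"
    and "m \<le> k"
  shows "\<beta>s k = b0"
  using \<open>m \<le> k\<close>
proof (induction k rule: dec_induct)
  case base
  show ?case by (rule start)
next
  case (step k)
  then show ?case
    using it fix_b0 unfolding lla_iterates_def by metis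
qed

theorem theorem2:
  fixes ell :: "real ^ 'p::finite \<Rightarrow> real"
    and beta_star beta_oracle g :: "real ^ 'p"
    and A :: "'p set"
    and lam a1 a2 a :: real
    and P :: "real \<Rightarrow> real"
  assumes "convex_on UNIV ell"
    and "A = {j. beta_star $ j \<noteq> 0}"
    and "0 < lam"
    and "folded_concave_penalty a1 a2 a lam P"
    and "is_oracle_estimator ell A beta_oracle"
    and "is_subgradient ell beta_oracle g"
    and "\<forall>j\<in>A. g $ j = 0"
    and "sub_max_norm (- A) g < ereal (a1 * lam)"
    and "ereal (a * lam) < sub_min_norm A beta_oracle"
  shows "(\<forall>b. lla_step ell P beta_oracle b \<longleftrightarrow> b = beta_oracle) \<and>
    (\<forall>\<beta>s m. lla_iterates ell P \<beta>s \<and> \<beta>s m = beta_oracle \<longrightarrow>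
       \<beta>s (Suc m) = beta_oracle \<and> (\<forall>k\<ge>m. \<beta>s k = beta_oracle) \<and> \<beta>s \<longlonglongrightarrow> beta_oracle)"
proof -
  \<comment> \<open>Entries on \<open>A\<close> exceed \<open>a * lam\<close> and so lie in the flat
    part of the penalty.\<close>
  have wA: "penalty_deriv P \<bar>beta_oracle $ j\<bar> = 0" if "j \<in> A" for j
    using abs_greater_if_sub_min_norm_greater[OF assms(9) that] assms(4)
    by (simp add: folded_concave_penalty_def)
  \<comment> \<open>The threshold \<open>a1 * lam\<close> separates the subgradient from the slope
    of the penalty at \<open>0\<close>.\<close>
  have gw: "\<bar>g $ j\<bar> < penalty_deriv P 0" if "j \<notin> A" for j
    using abs_less_if_sub_max_norm_less[OF assms(8), of j] that assms(4)
    by (auto simp: folded_concave_penalty_def)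
  have step: "lla_step ell P beta_oracle b \<longleftrightarrow> b = beta_oracle" for b
    by (rule lla_step_oracle_iff[OF assms(5,6) bspec[OF assms(7)] wA gw])
  have stay: "\<beta>s k = beta_oracle"
    if "lla_iterates ell P \<beta>s" "\<beta>s m = beta_oracle" "m \<le> k" for \<beta>s m k
    by (rule lla_iterates_fixed_point[OF that(1,2) iffD1[OF step] that(3)])
  have conv: "\<beta>s \<longlonglongrightarrow> beta_oracle"
    if "lla_iterates ell P \<beta>s" "\<beta>s m = beta_oracle" for \<beta>s m
    \<comment> \<open>The sequence is constant from index \<open>m\<close> on.\<close>
    using stay[OF that] by (intro tendsto_eventually eventually_sequentiallyI[of m])
  show ?thesis
  proof (intro conjI allI impI; (elim conjE)?)
    fix \<beta>s m k
    assume it: "lla_iterates ell P \<beta>s" "\<beta>s m = beta_oracle"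
    show "\<beta>s (Suc m) = beta_oracle"
      by (rule stay[OF it]) simp
    show "\<beta>s k = beta_oracle" if "m \<le> k"
      using stay[OF it that] .
    show "\<beta>s \<longlonglongrightarrow> beta_oracle"
      by (rule conv[OF it])
  qed (rule step)
qed

end
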